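(* Suppose that $\gamma(t)=\frac{\alpha}{t}$ with $\alpha>0$ and $\delta(t)=\frac{t}{\beta_0\alpha}$ with $\beta_0>0$. Let $(x^*,y^*,\lambda^* )\in\Omega$ and let $(x(t),y(t),\lambda(t))$ be a global solution of the dynamical system (S) (given in the context). Then: i) If $\alpha\le 3$ and $\beta_0=\frac23$, then (a) $\mathcal{L}(x(t),y(t),\lambda^* )-\mathcal{L}(x^*,y^*,\lambda^* )=\mathcal{O}(t^{-\frac{2\alpha}{3}})$; (b) $\|Ax(t)+By(t)-b\|=\mathcal{O}(t^{-\frac{\alpha}{3}})$; (c) $\int_{t_0}^{+\infty}t^{\frac{2\alpha}{3}-1}\|Ax(t)+By(t)-b\|^2\,dt<+\infty$; (d) $\int_{t_0}^{+\infty}t^m\big(\mathcal{L}(x(t),y(t),\lambda^* )-\mathcal{L}(x^*,y^*,\lambda^* )\big)\,dt<+\infty$ for all $m\in(-1,\frac{2\alpha}{3}-1)$; (e) $\int_{t_0}^{+\infty}t^m\big(\|\dot x(t)\|^2+\|\dot y(t)\|^2+\|\dot\lambda(t)\|^2\big)\,dt<+\infty$ for all $m\in(-1,\frac{2\alpha}{3}-1)$; (f) $\|\dot x(t)\|+\|\dot y(t)\|+\|\dot\lambda(t)\|=\mathcal{O}(t^{-m})$ for all $m\in(0,\frac{\alpha}{3})$. Moreover, if $\alpha<3$ (and $\beta_0=\frac23$), then (g) $\|\dot x(t)\|+\|\dot y(t)\|+\|\dot\lambda(t)\|=\mathcal{O}(t^{-\frac{\alpha}{3}})$. ii) If $\alpha>3$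 and $\beta_0\in(\frac{2}{\alpha},1-\frac{1}{\alpha})$, then (a') $\mathcal{L}(x(t),y(t),\lambda^* )-\mathcal{L}(x^*,y^*,\lambda^* )=\mathcal{O}(t^{-2})$; (b') $\|Ax(t)+By(t)-b\|=\mathcal{O}(t^{-1})$; (c') $\int_{t_0}^{+\infty}t\|Ax(t)+By(t)-b\|^2\,dt<+\infty$; (d') $\int_{t_0}^{+\infty}t\big(\mathcal{L}(x(t),y(t),\lambda^* )-\mathcal{L}(x^*,y^*,\lambda^* )\big)\,dt<+\infty$; (e') $\int_{t_0}^{+\infty}t\big(\|\dot x(t)\|^2+\|\dot y(t)\|^2+\|\dot\lambda(t)\|^2\big)\,dt<+\infty$; (f') $\|\dot x(t)\|+\|\dot y(t)\|+\|\dot\lambda(t)\|=\mathcal{O}(t^{-1})$.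
   Context: All spaces are Euclidean with inner product $\langle\cdot,\cdot\rangle$ and norm $\|\cdot\|$; $t_0>0$ is fixed. $f:\mathbb{R}^{n_1}\to\mathbb{R}$ and $g:\mathbb{R}^{n_2}\to\mathbb{R}$ are smooth (continuously differentiable) convex functions, $A\in\mathbb{R}^{m\times n_1}$, $B\in\mathbb{R}^{m\times n_2}$, $b\in\mathbb{R}^m$ (the dimension $m$ is unrelated to the exponent $m$ in the claim). $\Omega$ is the set of $(x^*,y^*,\lambda^* )\in\mathbb{R}^{n_1}\times\mathbb{R}^{n_2}\times\mathbb{R}^m$ with $-A^T\lambda^*=\nabla f(x^* )$, $-B^T\lambda^*=\nabla g(y^* )$, $Ax^*+By^*-b=0$; it is assumed that $\Omega\neq\emptyset$. The augmented Lagrangian is $$\mathcal{L}(x,y,\lambda)=f(x)+g(y)+\langle\lambda,Ax+By-b\rangle+\tfrac12\|Ax+By-b\|^2.$$ The dynamical system (S) is $$\begin{cases}\ddot{x}(t)+\gamma(t)\dot{x}(t)=-\nabla f(x(t))-A^T(\lambda(t)+\delta(t)\dot\lambda(t))-A^T(Ax(t)+By(t)-b),\\ \ddot{y}(t)+\gamma(t)\dot{y}(t)=-\nabla g(y(t))-B^T(\lambda(t)+\delta(t)\dot\lambda(t))-B^T(Ax(t)+By(t)-b),\\ \ddot{\lambda}(t)+\gamma(t)\dot{\lambda}(t)=A(x(t)+\delta(t)\dot{x}(t))+B(y(t)+\delta(t)\dot{y}(t))-b.\end{cases}$$ A global solution is a triple of $C^2$ functions on $[t_0,+\infty)$ satisfying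 (S) for all $t\ge t_0$. All $\mathcal{O}(\cdot)$ statements are as $t\to+\infty$. *)

theory Defs
  imports "HOL-Analysis.Analysis" "HOL-Library.Landau_Symbols"
begin

definition C1_convex_with_gradient ::
  "('a::euclidean_space \<Rightarrow> real) \<Rightarrow> ('a \<Rightarrow> 'a) \<Rightarrow> bool" where
  "C1_convex_with_gradient f grad_f \<longleftrightarrow>
     convex_on UNIV f \<and> (\<forall>x. GDERIV f x :> grad_f x) \<and> continuous_on UNIV grad_f"

definition aug_lagrangian ::
  "(real^'n1 \<Rightarrow> real) \<Rightarrow> (real^'n2 \<Rightarrow> real) \<Rightarrow> real^'n1^'m \<Rightarrow> real^'n2^'m \<Rightarrow> real^'m \<Rightarrow>
   real^'n1 \<Rightarrow> real^'n2 \<Rightarrow> real^'m \<Rightarrow> real" where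
  "aug_lagrangian f g A B b x y lam =
     f x + g y + lam \<bullet> (A *v x + B *v y - b) + 1/2 * (norm (A *v x + B *v y - b))\<^sup>2"

definition KKT_set ::
  "(real^'n1 \<Rightarrow> real^'n1) \<Rightarrow> (real^'n2 \<Rightarrow> real^'n2) \<Rightarrow>
   real^'n1^'m \<Rightarrow> real^'n2^'m \<Rightarrow> real^'m \<Rightarrow> ((real^'n1) \<times> (real^'n2) \<times> (real^'m)) set" where
  "KKT_set grad_f grad_g A B b =
     {(x, y, lam). - (transpose A *v lam) = grad_f x \<and>
                  - (transpose B *v lam) = grad_g y \<and>
                  A *v x + B *v y - b = 0}"

(* The derivatives at the left endpoint t0 are one-sided. *)
definition C2_with_derivs ::
  "real \<Rightarrow> (real \<Rightarrow> 'a::real_normed_vector) \<Rightarrow> (real \<Rightarrow> 'a) \<Rightarrow> (real \<Rightarrow> 'a) \<Rightarrow> bool" where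
  "C2_with_derivs t0 x x' x'' \<longleftrightarrow>
     (\<forall>t\<ge>t0. (x has_vector_derivative x' t) (at t within {t0..})) \<and>
     (\<forall>t\<ge>t0. (x' has_vector_derivative x'' t) (at t within {t0..})) \<and>
     continuous_on {t0..} x''"

(* Primed arguments are the first and second time derivatives of the trajectory; on {t0..}
   they are uniquely determined by it. *)
definition global_solution ::
  "real \<Rightarrow> (real \<Rightarrow> real) \<Rightarrow> (real \<Rightarrow> real) \<Rightarrow>
   (real^'n1 \<Rightarrow> real^'n1) \<Rightarrow> (real^'n2 \<Rightarrow> real^'n2) \<Rightarrow>
   real^'n1^'m \<Rightarrow> real^'n2^'m \<Rightarrow> real^'m \<Rightarrow>
   (real \<Rightarrow> real^'n1) \<Rightarrow> (real \<Rightarrow> real^'n1) \<Rightarrow> (real \<Rightarrow> real^'n1) \<Rightarrow>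
   (real \<Rightarrow> real^'n2) \<Rightarrow> (real \<Rightarrow> real^'n2) \<Rightarrow> (real \<Rightarrow> real^'n2) \<Rightarrow>
   (real \<Rightarrow> real^'m) \<Rightarrow> (real \<Rightarrow> real^'m) \<Rightarrow> (real \<Rightarrow> real^'m) \<Rightarrow> bool" where
  "global_solution t0 \<gamma> \<delta> grad_f grad_g A B b x x' x'' y y' y'' lam lam' lam'' \<longleftrightarrow>
     C2_with_derivs t0 x x' x'' \<and> C2_with_derivs t0 y y' y'' \<and> C2_with_derivs t0 lam lam' lam'' \<and>
     (\<forall>t\<ge>t0.
        x'' t + \<gamma> t *\<^sub>R x' t =
          - grad_f (x t) - transpose A *v (lam t + \<delta> t *\<^sub>R lam' t)
          - transpose A *v (A *v x t + B *v y t - b) \<and>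
        y'' t + \<gamma> t *\<^sub>R y' t =
          - grad_g (y t) - transpose B *v (lam t + \<delta> t *\<^sub>R lam' t)
          - transpose B *v (A *v x t + B *v y t - b) \<and>
        lam'' t + \<gamma> t *\<^sub>R lam' t =
          A *v (x t + \<delta> t *\<^sub>R x' t) + B *v (y t + \<delta> t *\<^sub>R y' t) - b)"

end

theory Submission
  imports Defs
begin

text \<open>
  Write \<open>w = (x - x\<^sup>*, y - y\<^sup>*, \<lambda> - \<lambda>\<^sup>*)\<close> for the deviation from the given KKT point,
  \<open>\<phi> = \<L>(x, y, \<lambda>\<^sup>*) - \<L>(x\<^sup>*, y\<^sup>*, \<lambda>\<^sup>*)\<close> for the gap, and \<open>c = \<beta>\<^sub>0\<alpha>\<close>. The system is
  \<open>w'' + (\<alpha>/t) w' = -\<nabla>\<phi> - K (w + (t/c) w')\<close>, where \<open>K\<close> is the skew operator that couples primal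
  and dual variables. Since \<open>K\<close> is skew, it does no work along \<open>v = c w + t w'\<close>, which is
  \<open>c\<close> times the extrapolated point at which \<open>K\<close> is evaluated. So an energy built from \<open>v\<close>
  does not see the coupling, and the argument becomes the one for a damped gradient flow:
  \<open>E(t) = t\<^sup>q (t\<^sup>2 \<phi> + |v|\<^sup>2/2 + (\<xi>/2) |w|\<^sup>2)\<close>, with \<open>\<xi>\<close> chosen to cancel the cross term
  \<open>\<langle>w, w'\<rangle>\<close> in \<open>E'\<close>, satisfies
  \<open>E' \<le> - t\<^sup>q\<^sup>+\<^sup>1 ((c - 2 - q) \<phi> + (c/2) |r|\<^sup>2 + (\<alpha> - c - 1 - q/2) |w'|\<^sup>2)\<close>,
  where \<open>r = Ax + By - b\<close> (\<open>energy_derivative\<close>). The \<open>|r|\<^sup>2\<close> term survives because the quadratic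
  penalty makes \<open>\<phi>\<close> exceed its convexity inequality by \<open>|r|\<^sup>2/2\<close>.

  The three coefficients are nonnegative when \<open>2 + q \<le> c\<close> and \<open>c + 1 + q/2 \<le> \<alpha>\<close>. For
  \<open>\<alpha> \<le> 3\<close> and \<open>c = 2\<alpha>/3\<close> both hold with equality for \<open>q = c - 2 \<le> 0\<close>; for \<open>\<alpha> > 3\<close> and
  \<open>2 < c < \<alpha> - 1\<close> both are strict for \<open>q = 0\<close>. Boundedness of \<open>E\<close> gives the rates of \<open>\<phi>\<close> and of
  \<open>r\<close>, since \<open>|r|\<^sup>2 \<le> 2\<phi>\<close>, and the growth of \<open>v\<close>. The growth of \<open>w\<close> follows from that of \<open>v\<close>
  by integrating \<open>(t\<^sup>c w)' = t\<^sup>c\<^sup>-\<^sup>1 v\<close> (\<open>position_bound\<close>), and then \<open>t w' = v - c w\<close> bounds the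
  velocity; this argument covers \<open>\<alpha> = 3\<close>, where \<open>\<xi> = 0\<close> and the energy itself does not control
  \<open>w\<close>. Integrability comes from the dissipated terms with positive coefficient. For
  \<open>\<alpha> \<le> 3\<close> the coefficients of \<open>\<phi>\<close> and \<open>|w'|\<^sup>2\<close> vanish; there the pointwise rates suffice,
  because the exponents \<open>m\<close> lie strictly below the critical one.
\<close>

section \<open>Convexity along a gradient\<close>

text \<open>The one-variable tangent inequality, applied to the restriction of \<open>f\<close> to the line through
  \<open>z\<close> and \<open>u\<close>.\<close>

lemma convex_on_gderiv_above_tangent:
  fixes f :: "'a::real_inner \<Rightarrow> real"
  assumes "convex_on UNIV f" "GDERIV f z :> d"
  shows "f z + d \<bullet> (u - z) \<le> f u"
proof -
  define h where "h = (\<lambda>s::real. f (z + s *\<^sub>R (u - z)))"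
  have "convex_on UNIV h"
  proof (rule convex_onI)
    fix t a b :: real assume t: "0 < t" "t < 1"
    have eq: "z + ((1 - t) *\<^sub>R a + t *\<^sub>R b) *\<^sub>R (u - z)
       = (1 - t) *\<^sub>R (z + a *\<^sub>R (u - z)) + t *\<^sub>R (z + b *\<^sub>R (u - z))"
      by (simp add: algebra_simps)
    show "h ((1 - t) *\<^sub>R a + t *\<^sub>R b) \<le> (1 - t) * h a + t * h b"
      unfolding h_def eq using convex_onD[OF assms(1)] t by simp
  qed simp
  moreover have "(h has_field_derivative (d \<bullet> (u - z))) (at 0 within UNIV)"
  proof -
    have 1: "(f has_derivative (\<lambda>k. k \<bullet> d)) (at (z + 0 *\<^sub>R (u - z)))"
      using assms(2) by (simp add: gderiv_def)
    have 2: "((\<lambda>s::real. z + s *\<^sub>R (u - z)) has_derivative (\<lambda>s. s *\<^sub>R (u - z))) (at 0)"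
      by (auto intro!: derivative_eq_intros)
    show ?thesis
      using has_derivative_compose[OF 2 1] unfolding h_def has_field_derivative_def
      by (rule has_derivative_eq_rhs) (simp add: fun_eq_iff inner_commute)
  qed
  ultimately have "h 1 - h 0 \<ge> (d \<bullet> (u - z)) * (1 - 0)"
    by (intro convex_on_imp_above_tangent[where A = UNIV]) auto
  then show ?thesis by (simp add: h_def)
qed

section \<open>Integrability on a half-line\<close>

text \<open>The function \<open>E\<close> is a nonnegative budget which \<open>h\<close> consumes: the integral of \<open>h\<close> over any
  \<open>{a..T}\<close> is at most \<open>E a - E T \<le> E a\<close>, and monotone convergence passes to the half-line.\<close>

lemma set_integrable_of_dissipation:
  fixes h E E' :: "real \<Rightarrow> real"
  assumes cont: "continuous_on {a..} h"
    and h0: "\<And>t. t \<ge> a \<Longrightarrow> 0 \<le> h t"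
    and E0: "\<And>t. t \<ge> a \<Longrightarrow> 0 \<le> E t"
    and dE: "\<And>t. t \<ge> a \<Longrightarrow> (E has_real_derivative E' t) (at t within {a..})"
    and le: "\<And>t. t \<ge> a \<Longrightarrow> E' t \<le> - h t"
  shows "set_integrable lborel {a..} h"
proof -
  define k where "k = (\<lambda>n::nat. \<lambda>t. indicator {a..a + real n} t *\<^sub>R h t)"
  have contn: "continuous_on {a..T} h" for T
    by (rule continuous_on_subset[OF cont]) auto
  have int: "set_integrable lborel {a..T} h" for T
    by (rule borel_integrable_atLeastAtMost') (rule contn)
  have bound: "integral {a..T} h \<le> E a" if "a \<le> T" for T
  proof -
    have "(E' has_integral (E T - E a)) {a..T}"
    proof (rule fundamental_theorem_of_calculus[OF that])
      fix t assume "t \<in> {a..T}"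
      then show "(E has_vector_derivative E' t) (at t within {a..T})"
        using dE[of t] has_field_derivative_subset[of E "E' t" t "{a..}" "{a..T}"]
        by (auto simp: has_real_derivative_iff_has_vector_derivative[symmetric])
    qed
    moreover have "((\<lambda>t. - h t) has_integral (- integral {a..T} h)) {a..T}"
      by (intro has_integral_neg integrable_integral integrable_continuous_interval contn)
    ultimately have "E T - E a \<le> - integral {a..T} h"
      by (rule has_integral_le) (use le in auto)
    with E0[OF that] show ?thesis by simp
  qed
  have kint: "integrable lborel (k n)" for n
    using int[of "a + real n"] by (simp add: k_def set_integrable_def)
  have keq: "integral\<^sup>L lborel (k n) = integral {a..a + real n} h" for n
    using set_borel_integral_eq_integral(2)[OF int[of "a + real n"]]
    by (simp add: k_def set_lebesgue_integral_def)
  have kmono: "k n t \<le> k m t" if "n \<le> m" for n m t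
    using that h0[of t] by (auto simp: k_def indicator_def)
  have "incseq (\<lambda>n. integral\<^sup>L lborel (k n))"
    by (intro incseq_SucI integral_mono kint kmono) auto
  moreover have "integral\<^sup>L lborel (k n) \<le> E a" for n
    unfolding keq by (rule bound) simp
  ultimately obtain l where l: "(\<lambda>n. integral\<^sup>L lborel (k n)) \<longlonglongrightarrow> l"
    using incseq_convergent by blast
  have lim: "(\<lambda>n. k n t) \<longlonglongrightarrow> indicator {a..} t *\<^sub>R h t" for t
  proof (rule tendsto_eventually)
    obtain N :: nat where N: "t - a \<le> real N" using real_arch_simple by blast
    show "\<forall>\<^sub>F n in sequentially. k n t = indicator {a..} t *\<^sub>R h t"
      using eventually_ge_at_top[of N]
      by eventually_elim (use N in \<open>auto simp: k_def indicator_def\<close>)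
  qed
  have meas: "(\<lambda>t. indicator {a..} t *\<^sub>R h t) \<in> borel_measurable lborel"
    using borel_measurable_continuous_on_indicator[OF _ cont] by simp
  have "integrable lborel (\<lambda>t. indicator {a..} t *\<^sub>R h t)"
    by (rule integrable_monotone_convergence[where f = k, OF kint _ _ l meas])
       (use kmono lim in \<open>auto simp: mono_def\<close>)
  then show ?thesis by (simp add: set_integrable_def)
qed

text \<open>The budget is the tail \<open>C t powr (p + 1) / -(p + 1)\<close> of the integral of \<open>C t powr p\<close>.\<close>

lemma set_integrable_powr_dominated:
  fixes h :: "real \<Rightarrow> real"
  assumes "a > 0" "p < -1"
    and cont: "continuous_on {a..} h"
    and h0: "\<And>t. t \<ge> a \<Longrightarrow> 0 \<le> h t"
    and le: "\<And>t. t \<ge> a \<Longrightarrow> h t \<le> C * t powr p"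
  shows "set_integrable lborel {a..} h"
proof (rule set_integrable_of_dissipation[OF cont h0])
  have "0 \<le> C * a powr p" using h0[of a] le[of a] by simp
  then have C: "0 \<le> C" using assms(1) by (simp add: zero_le_mult_iff)
  define k where "k = - (p + 1)"
  have k: "k > 0" "p = - k - 1" using assms(2) by (auto simp: k_def)
  show "0 \<le> C / k * t powr (- k)" if "t \<ge> a" for t
    using C k by simp
  show "((\<lambda>t. C / k * t powr (- k)) has_real_derivative - (C * t powr p))
      (at t within {a..})" if "t \<ge> a" for t
    using that assms(1) k by (auto intro!: derivative_eq_intros)
  show "- (C * t powr p) \<le> - h t" if "t \<ge> a" for t
    using le[OF that] by simp
qed auto

section \<open>Inertial flows with vanishing damping and a skew coupling\<close>

text \<open>Everything the energy argument needs of the system, stated along one trajectory. \<open>G\<close> stands for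
  the gradient of the gap \<open>\<phi>\<close> and \<open>\<rho>\<close> for the squared residual. The coupling force \<open>S\<close> enters
  only through its orthogonality to \<open>c w + t w'\<close>, so no operator has to be mentioned. The
  parameter \<open>q\<close> is the exponent by which the energy is weighted: it is the price paid when
  \<open>\<alpha>\<close> is too small for the rate \<open>t powr (-2)\<close>. Its two constraints are the signs of the
  coefficients of \<open>\<phi>\<close> and of the squared speed in the dissipation.\<close>

locale skew_inertial_flow =
  fixes t0 \<alpha> c q :: real
    and w w' w'' G S :: "real \<Rightarrow> 'a::real_inner"
    and \<phi> \<rho> :: "real \<Rightarrow> real"
  assumes t0: "t0 > 0" and c: "c > 0" and q0: "q \<le> 0"
    and value_rate: "2 + q \<le> c" and damping_rate: "c + 1 + q / 2 \<le> \<alpha>"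
    and dw: "\<And>t. t \<ge> t0 \<Longrightarrow> (w has_vector_derivative w' t) (at t within {t0..})"
    and dw': "\<And>t. t \<ge> t0 \<Longrightarrow> (w' has_vector_derivative w'' t) (at t within {t0..})"
    and d\<phi>: "\<And>t. t \<ge> t0 \<Longrightarrow> (\<phi> has_real_derivative G t \<bullet> w' t) (at t within {t0..})"
    and flow: "\<And>t. t \<ge> t0 \<Longrightarrow> w'' t + (\<alpha> / t) *\<^sub>R w' t = - G t - S t"
    and skew: "\<And>t. t \<ge> t0 \<Longrightarrow> S t \<bullet> (c *\<^sub>R w t + t *\<^sub>R w' t) = 0"
    and tangent: "\<And>t. t \<ge> t0 \<Longrightarrow> \<phi> t + \<rho> t / 2 \<le> G t \<bullet> w t"
    and residual_le: "\<And>t. t \<ge> t0 \<Longrightarrow> \<rho> t / 2 \<le> \<phi> t"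
    and residual_nonneg: "\<And>t. t \<ge> t0 \<Longrightarrow> 0 \<le> \<rho> t"
    and cont_residual: "continuous_on {t0..} \<rho>"
begin

definition v :: "real \<Rightarrow> 'a" where "v t = c *\<^sub>R w t + t *\<^sub>R w' t"

text \<open>The coefficient for which the terms in \<open>w \<bullet> w'\<close> cancel in the derivative of the energy.\<close>

definition \<xi> :: real where "\<xi> = c * (\<alpha> - c - 1 - q)"

definition energy :: "real \<Rightarrow> real" where
  "energy t = t powr q * (t\<^sup>2 * \<phi> t + (v t \<bullet> v t) / 2 + \<xi> / 2 * (w t \<bullet> w t))"

definition dissipation :: "real \<Rightarrow> real" where
  "dissipation t = t powr (q + 1) * ((c - 2 - q) * \<phi> t + c / 2 * \<rho> t
     + (\<alpha> - c - 1 - q / 2) * (norm (w' t))\<^sup>2)"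

lemma \<xi>_nonneg: "0 \<le> \<xi>"
  unfolding \<xi>_def using c q0 damping_rate by (intro mult_nonneg_nonneg) auto

lemma value_nonneg: "t \<ge> t0 \<Longrightarrow> 0 \<le> \<phi> t"
  using residual_le[of t] residual_nonneg[of t] by simp

lemma dissipation_nonneg: "t \<ge> t0 \<Longrightarrow> 0 \<le> dissipation t"
  unfolding dissipation_def
  using value_rate damping_rate c value_nonneg residual_nonneg
  by (intro mult_nonneg_nonneg add_nonneg_nonneg) auto

lemma energy_nonneg: "t \<ge> t0 \<Longrightarrow> 0 \<le> energy t"
  unfolding energy_def using value_nonneg \<xi>_nonneg by auto

text \<open>The Lyapunov inequality. Along the flow \<open>v' = (c + 1 - \<alpha>) w' - t G - t S\<close>; here \<open>v \<bullet> S = 0\<close> by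
  skewness, the term \<open>t\<^sup>2 (G \<bullet> w')\<close> from \<open>v \<bullet> v'\<close> cancels against the derivative of \<open>\<phi>\<close>, and
  \<open>G \<bullet> w\<close> is bounded below by the tangent inequality. What remains of \<open>w \<bullet> w\<close> has the sign
  of \<open>q\<close> and is dropped.\<close>

lemma energy_derivative:
  assumes t: "t \<ge> t0"
  shows "\<exists>E'. (energy has_real_derivative E') (at t within {t0..}) \<and> E' \<le> - dissipation t"
proof -
  have tpos: "t > 0" using t t0 by simp
  define V' where "V' = (c + 1 - \<alpha>) *\<^sub>R w' t - t *\<^sub>R G t - t *\<^sub>R S t"
  have tw'': "t *\<^sub>R w'' t = - (\<alpha> *\<^sub>R w' t) - t *\<^sub>R G t - t *\<^sub>R S t"
  proof -
    have "w'' t = - G t - S t - (\<alpha> / t) *\<^sub>R w' t" using flow[OF t] by (simp add: eq_diff_eq)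
    then show ?thesis using tpos by (simp add: scaleR_diff_right)
  qed
  have dv: "(v has_vector_derivative V') (at t within {t0..})"
  proof -
    have "(v has_vector_derivative (c *\<^sub>R w' t + (t *\<^sub>R w'' t + 1 *\<^sub>R w' t))) (at t within {t0..})"
      unfolding v_def[abs_def]
      by (rule has_vector_derivative_add[OF
            bounded_linear.has_vector_derivative[OF bounded_linear_scaleR_right dw[OF t]]
            has_vector_derivative_scaleR[OF DERIV_ident dw'[OF t]]])
    then show ?thesis unfolding V'_def tw'' by (simp add: algebra_simps)
  qed
  have sq: "((\<lambda>s. u s \<bullet> u s) has_real_derivative 2 * (u t \<bullet> u')) (at t within {t0..})"
    if "(u has_vector_derivative u') (at t within {t0..})" for u :: "real \<Rightarrow> 'a" and u'
    using has_derivative_inner[OF that[unfolded has_vector_derivative_def]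
        that[unfolded has_vector_derivative_def]]
    unfolding has_field_derivative_def
    by (rule has_derivative_eq_rhs) (auto simp: fun_eq_iff inner_commute algebra_simps)
  \<comment> \<open>In these scalars the inequality is a polynomial identity plus two sign facts.\<close>
  define P Q R where "P = w t \<bullet> w t" and "Q = w t \<bullet> w' t" and "R = w' t \<bullet> w' t"
  define N where "N = t\<^sup>2 * \<phi> t + (v t \<bullet> v t) / 2 + \<xi> / 2 * (w t \<bullet> w t)"
  define N' where "N' = 2 * t * \<phi> t + t\<^sup>2 * (G t \<bullet> w' t) + v t \<bullet> V' + \<xi> * Q"
  have dN: "((\<lambda>t. t\<^sup>2 * \<phi> t + (v t \<bullet> v t) / 2 + \<xi> / 2 * (w t \<bullet> w t)) has_real_derivative N')
      (at t within {t0..})"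
  proof -
    have d2: "((\<lambda>s. s\<^sup>2) has_real_derivative 2 * t) (at t within {t0..})"
      by (auto intro!: derivative_eq_intros)
    show ?thesis
      unfolding N'_def Q_def
      using DERIV_add[OF DERIV_add[OF DERIV_mult[OF d2 d\<phi>[OF t]]
            DERIV_cdivide[OF sq[OF dv], of 2]] DERIV_cmult[OF sq[OF dw[OF t]], of "\<xi> / 2"]]
      by (simp add: algebra_simps)
  qed
  define E' where "E' = t powr q * N' + q * t powr (q - 1) * N"
  have dpow: "((\<lambda>s. s powr q) has_real_derivative q * t powr (q - 1)) (at t within {t0..})"
    using tpos by (auto intro!: derivative_eq_intros)
  have dE: "(energy has_real_derivative E') (at t within {t0..})"
    using DERIV_mult[OF dpow dN] unfolding energy_def[abs_def] E'_def N_def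
    by (simp add: algebra_simps)
  have vV: "v t \<bullet> V' = (c + 1 - \<alpha>) * (c * Q + t * R) - t * (c * (G t \<bullet> w t) + t * (G t \<bullet> w' t))"
  proof -
    have "v t \<bullet> S t = 0" using skew[OF t] by (simp add: v_def inner_commute)
    then have "v t \<bullet> V' = (c + 1 - \<alpha>) * (v t \<bullet> w' t) - t * (v t \<bullet> G t)"
      unfolding V'_def by (simp add: inner_diff_right)
    then show ?thesis
      by (simp add: v_def Q_def R_def inner_add_left inner_commute[of "G t"])
  qed
  have vv: "v t \<bullet> v t = c\<^sup>2 * P + 2 * c * t * Q + t\<^sup>2 * R"
    unfolding v_def P_def Q_def R_def
    by (simp add: inner_add_left inner_add_right inner_commute[of "w' t" "w t"]
        power2_eq_square algebra_simps)
  have eq: "q * N + t * N' = t\<^sup>2 * ((q + 2) * \<phi> t) + q / 2 * ((c\<^sup>2 + \<xi>) * P)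
      + t\<^sup>2 * ((q / 2 + c + 1 - \<alpha>) * R) - t\<^sup>2 * (c * (G t \<bullet> w t))"
    unfolding N_def N'_def vV vv \<xi>_def P_def[symmetric] by (simp add: power2_eq_square field_simps)
  have "q / 2 * ((c\<^sup>2 + \<xi>) * P) \<le> 0"
    using q0 \<xi>_nonneg by (intro mult_nonpos_nonneg mult_nonneg_nonneg) (auto simp: P_def)
  moreover have "t\<^sup>2 * (c * (\<phi> t + \<rho> t / 2)) \<le> t\<^sup>2 * (c * (G t \<bullet> w t))"
    using tangent[OF t] c by (intro mult_left_mono) auto
  ultimately have main: "q * N + t * N' \<le>
      - (t\<^sup>2 * ((c - 2 - q) * \<phi> t + c / 2 * \<rho> t + (\<alpha> - c - 1 - q / 2) * R))"
    unfolding eq by (simp add: algebra_simps)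
  have pw: "t powr q = t powr (q - 1) * t" "t powr (q + 1) = t powr (q - 1) * t\<^sup>2"
    using tpos by (simp_all add: powr_diff powr_add power2_eq_square)
  have "E' = t powr (q - 1) * (q * N + t * N')"
    unfolding E'_def pw(1) by (simp add: algebra_simps)
  also have "\<dots> \<le> t powr (q - 1) *
      (- (t\<^sup>2 * ((c - 2 - q) * \<phi> t + c / 2 * \<rho> t + (\<alpha> - c - 1 - q / 2) * R)))"
    by (intro mult_left_mono main) simp
  also have "\<dots> = - dissipation t"
    unfolding dissipation_def pw(2) R_def by (simp add: power2_norm_eq_inner)
  finally show ?thesis using dE by blast
qed

lemma energy_le_initial:
  assumes t: "t \<ge> t0"
  shows "energy t \<le> energy t0"
proof (rule DERIV_nonpos_imp_decreasing_open[OF t])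
  show "\<exists>y. (energy has_real_derivative y) (at s) \<and> y \<le> 0" if s: "t0 < s" "s < t" for s
  proof -
    have "at s within {t0..} = at s"
      by (rule at_within_open_subset[of s "{t0<..}"]) (use s in auto)
    moreover obtain E' where "(energy has_real_derivative E') (at s within {t0..})"
      and "E' \<le> - dissipation s"
      using energy_derivative[OF less_imp_le[OF s(1)]] by blast
    moreover have "0 \<le> dissipation s" using dissipation_nonneg[of s] s by simp
    ultimately show ?thesis by (intro exI[of _ E']) simp
  qed
  have "continuous (at s within {t0..}) energy" if "s \<ge> t0" for s
    using energy_derivative[OF that] DERIV_continuous by blast
  then have "continuous_on {t0..} energy"
    by (simp add: continuous_on_eq_continuous_within)
  then show "continuous_on {t0..t} energy"
    by (rule continuous_on_subset) auto
qed

lemma value_bound: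
  assumes t: "t \<ge> t0"
  shows "\<phi> t \<le> energy t0 * t powr (- (q + 2))"
proof -
  have tpos: "t > 0" using t t0 by simp
  have "t powr (q + 2) * \<phi> t = t powr q * (t\<^sup>2 * \<phi> t)"
    using tpos by (simp add: powr_add)
  also have "\<dots> \<le> energy t"
    unfolding energy_def using \<xi>_nonneg by (intro mult_left_mono) auto
  also have "\<dots> \<le> energy t0" by (rule energy_le_initial[OF t])
  finally have "t powr (- (q + 2)) * (t powr (q + 2) * \<phi> t) \<le> t powr (- (q + 2)) * energy t0"
    by (intro mult_left_mono) auto
  moreover have "t powr (- (q + 2)) * (t powr (q + 2) * \<phi> t) = \<phi> t"
    using tpos by (simp add: mult.assoc[symmetric] powr_add[symmetric])
  ultimately show ?thesis by (simp only: mult.commute[of "energy t0"])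
qed

lemma v_bound:
  assumes t: "t \<ge> t0"
  shows "norm (v t) \<le> sqrt (2 * energy t0) * t powr (- q / 2)"
proof (rule power2_le_imp_le)
  have tpos: "t > 0" using t t0 by simp
  have "t powr q * ((norm (v t))\<^sup>2 / 2) \<le> energy t"
    unfolding energy_def using \<xi>_nonneg value_nonneg[OF t]
    by (intro mult_left_mono) (auto simp: power2_norm_eq_inner)
  also have "\<dots> \<le> energy t0" by (rule energy_le_initial[OF t])
  finally have "t powr (- q) * (t powr q * (norm (v t))\<^sup>2) \<le> t powr (- q) * (2 * energy t0)"
    by (intro mult_left_mono) auto
  moreover have "t powr (- q) * (t powr q * (norm (v t))\<^sup>2) = (norm (v t))\<^sup>2"
    using tpos by (simp add: mult.assoc[symmetric] powr_add[symmetric])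
  moreover have "(t powr (- q / 2))\<^sup>2 = t powr (- q)"
    by (simp add: power2_eq_square powr_add[symmetric])
  ultimately show "(norm (v t))\<^sup>2 \<le> (sqrt (2 * energy t0) * t powr (- q / 2))\<^sup>2"
    using energy_nonneg[of t0] by (simp add: power_mult_distrib mult.commute)
qed (use energy_nonneg[of t0] in auto)

text \<open>Since \<open>(t\<^sup>c w)' = t\<^sup>c\<^sup>-\<^sup>1 v\<close>, the growth of \<open>v\<close> integrates to that of \<open>w\<close>; the exponent
  \<open>c - q/2\<close> that appears is positive, so that power of \<open>t\<close> also absorbs the initial value.
  Reading the bound off the term \<open>\<xi> |w|\<^sup>2\<close> of the energy would fail when \<open>\<xi> = 0\<close>.\<close>

lemma position_bound: "\<exists>C. \<forall>t\<ge>t0. norm (w t) \<le> C * t powr (- q / 2)"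
proof -
  define K where "K = sqrt (2 * energy t0) / (c - q / 2)"
  define b where "b = (\<lambda>t. K * t powr (c - q / 2))"
  define D where "D = norm (t0 powr c *\<^sub>R w t0) / t0 powr (c - q / 2) + K"
  have cq: "c - q / 2 > 0" using c q0 by simp
  have K: "K \<ge> 0" unfolding K_def using cq energy_nonneg[of t0] by simp
  have du: "((\<lambda>s. s powr c *\<^sub>R w s) has_vector_derivative t powr (c - 1) *\<^sub>R v t)
      (at t within {t0..})" if "t \<ge> t0" for t
  proof -
    have tpos: "t > 0" using that t0 by simp
    have "((\<lambda>s. s powr c) has_real_derivative c * t powr (c - 1)) (at t within {t0..})"
      using tpos by (auto intro!: derivative_eq_intros)
    from has_vector_derivative_scaleR[OF this dw[OF that]] show ?thesis
      using tpos by (simp add: v_def powr_diff algebra_simps)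
  qed
  have db: "(b has_vector_derivative sqrt (2 * energy t0) * t powr (c - q / 2 - 1))
      (at t within {t0..})" if "t \<ge> t0" for t
    unfolding b_def K_def has_real_derivative_iff_has_vector_derivative[symmetric]
    using that t0 cq by (auto intro!: derivative_eq_intros)
  \<comment> \<open>\<open>b\<close> is a primitive of the bound on the derivative of \<open>t powr c *\<^sub>R w t\<close>.\<close>
  have growth: "norm (t powr c *\<^sub>R w t - t0 powr c *\<^sub>R w t0) \<le> b t - b t0" if t: "t0 < t" for t
  proof (rule differentiable_bound_general[OF t])
    have "continuous_on {t0..} (\<lambda>s. s powr c *\<^sub>R w s)"
      by (rule continuous_on_vector_derivative, rule du) simp
    then show "continuous_on {t0..t} (\<lambda>s. s powr c *\<^sub>R w s)"
      by (rule continuous_on_subset) auto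
    have "continuous_on {t0..} b"
      by (rule continuous_on_vector_derivative, rule db) simp
    then show "continuous_on {t0..t} b"
      by (rule continuous_on_subset) auto
    fix s assume s: "t0 < s" "s < t"
    have at: "at s within {t0..} = at s"
      by (rule at_within_open_subset[of s "{t0<..}"]) (use s in auto)
    show "((\<lambda>s. s powr c *\<^sub>R w s) has_vector_derivative s powr (c - 1) *\<^sub>R v s) (at s)"
      "(b has_vector_derivative sqrt (2 * energy t0) * s powr (c - q / 2 - 1)) (at s)"
      using du[of s] db[of s] s at by simp_all
    have "norm (s powr (c - 1) *\<^sub>R v s) \<le> s powr (c - 1) * (sqrt (2 * energy t0) * s powr (- q / 2))"
      using v_bound[of s] s by (simp add: mult_left_mono)
    also have "\<dots> = sqrt (2 * energy t0) * s powr (c - q / 2 - 1)"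
      by (simp add: powr_add[symmetric] algebra_simps)
    finally show "norm (s powr (c - 1) *\<^sub>R v s) \<le> sqrt (2 * energy t0) * s powr (c - q / 2 - 1)" .
  qed
  have "norm (w t) \<le> D * t powr (- q / 2)" if t: "t \<ge> t0" for t
  proof -
    have tpos: "t > 0" using t t0 by simp
    have "t powr c * norm (w t) = norm (t powr c *\<^sub>R w t)" by simp
    also have "\<dots> \<le> norm (t0 powr c *\<^sub>R w t0) + b t"
    proof (cases "t = t0")
      case False
      have "0 \<le> b t0" using K by (simp add: b_def)
      with growth[of t] False t show ?thesis
        using norm_triangle_ineq2[of "t powr c *\<^sub>R w t" "t0 powr c *\<^sub>R w t0"] by linarith
    qed (use K in \<open>auto simp: b_def\<close>)
    also have "\<dots> \<le> D * t powr (c - q / 2)"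
    proof -
      have "t0 powr (c - q / 2) \<le> t powr (c - q / 2)"
        using t t0 cq by (intro powr_mono2) auto
      then have "norm (t0 powr c *\<^sub>R w t0) * 1 \<le>
          norm (t0 powr c *\<^sub>R w t0) * (t powr (c - q / 2) / t0 powr (c - q / 2))"
        using t0 by (intro mult_left_mono) auto
      then show ?thesis unfolding D_def b_def by (simp add: algebra_simps)
    qed
    also have "\<dots> = t powr c * (D * t powr (- q / 2))"
      using powr_add[of t c "- q / 2"] by simp
    finally show ?thesis using tpos by simp
  qed
  then show ?thesis by blast
qed

lemma velocity_bound: "\<exists>C. \<forall>t\<ge>t0. norm (w' t) \<le> C * t powr (- (q / 2 + 1))"
proof -
  obtain D where D: "\<And>t. t \<ge> t0 \<Longrightarrow> norm (w t) \<le> D * t powr (- q / 2)"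
    using position_bound by blast
  have "norm (w' t) \<le> (sqrt (2 * energy t0) + c * D) * t powr (- (q / 2 + 1))" if t: "t \<ge> t0" for t
  proof -
    have tpos: "t > 0" using t t0 by simp
    have "t * norm (w' t) = norm (v t - c *\<^sub>R w t)" using tpos by (simp add: v_def)
    also have "\<dots> \<le> norm (v t) + c * norm (w t)"
      using norm_triangle_ineq4[of "v t" "c *\<^sub>R w t"] c by simp
    also have "\<dots> \<le> sqrt (2 * energy t0) * t powr (- q / 2) + c * (D * t powr (- q / 2))"
      using v_bound[OF t] D[OF t] c by (intro add_mono mult_left_mono) auto
    also have "\<dots> = t * ((sqrt (2 * energy t0) + c * D) * t powr (- (q / 2 + 1)))"
    proof -
      have "t powr (- q / 2) = t * t powr (- (q / 2 + 1))"
        using tpos powr_add[of t 1 "- (q / 2 + 1)"] by simp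
      then show ?thesis by (simp add: algebra_simps)
    qed
    finally show ?thesis using tpos by simp
  qed
  then show ?thesis by blast
qed

lemma set_integrable_of_le_dissipation:
  assumes "continuous_on {t0..} h" and "\<And>t. t \<ge> t0 \<Longrightarrow> 0 \<le> h t"
    and "k > 0" and le: "\<And>t. t \<ge> t0 \<Longrightarrow> k * h t \<le> dissipation t"
  shows "set_integrable lborel {t0..} h"
proof -
  obtain E' where E': "\<And>t. t \<ge> t0 \<Longrightarrow>
      (energy has_real_derivative E' t) (at t within {t0..}) \<and> E' t \<le> - dissipation t"
    using energy_derivative by metis
  show ?thesis
  proof (rule set_integrable_of_dissipation[OF assms(1,2)])
    fix t assume t: "t0 \<le> t"
    show "0 \<le> energy t / k" using energy_nonneg[OF t] \<open>k > 0\<close> by simp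
    show "((\<lambda>t. energy t / k) has_real_derivative E' t / k) (at t within {t0..})"
      using E'[OF t] by (intro DERIV_cdivide) auto
    have "k * h t \<le> - E' t" using E'[OF t] le[OF t] by linarith
    then show "E' t / k \<le> - h t" using \<open>k > 0\<close> by (simp add: field_simps)
  qed
qed

lemma continuous_value: "continuous_on {t0..} \<phi>"
  using d\<phi> by (auto simp: continuous_on_eq_continuous_within intro: DERIV_continuous)

lemma continuous_velocity: "continuous_on {t0..} w'"
  using dw' by (auto simp: continuous_on_eq_continuous_within
      intro: has_vector_derivative_continuous)

lemma continuous_power: "continuous_on {t0..} (\<lambda>t. t powr p)"
  using t0 by (intro continuous_intros) auto

lemma dissipation_terms:
  assumes "t \<ge> t0"
  shows "(c - 2 - q) * (t powr (q + 1) * \<phi> t) \<le> dissipation t"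
    and "c / 2 * (t powr (q + 1) * \<rho> t) \<le> dissipation t"
    and "(\<alpha> - c - 1 - q / 2) * (t powr (q + 1) * (norm (w' t))\<^sup>2) \<le> dissipation t"
proof -
  have nn: "0 \<le> (c - 2 - q) * (t powr (q + 1) * \<phi> t)" "0 \<le> c / 2 * (t powr (q + 1) * \<rho> t)"
    "0 \<le> (\<alpha> - c - 1 - q / 2) * (t powr (q + 1) * (norm (w' t))\<^sup>2)"
    using value_rate damping_rate c value_nonneg[OF assms] residual_nonneg[OF assms] by auto
  have "dissipation t = (c - 2 - q) * (t powr (q + 1) * \<phi> t) + c / 2 * (t powr (q + 1) * \<rho> t)
      + (\<alpha> - c - 1 - q / 2) * (t powr (q + 1) * (norm (w' t))\<^sup>2)"
    unfolding dissipation_def by (simp add: algebra_simps)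
  with nn show "(c - 2 - q) * (t powr (q + 1) * \<phi> t) \<le> dissipation t"
    "c / 2 * (t powr (q + 1) * \<rho> t) \<le> dissipation t"
    "(\<alpha> - c - 1 - q / 2) * (t powr (q + 1) * (norm (w' t))\<^sup>2) \<le> dissipation t"
    by linarith+
qed

lemma integrable_residual: "set_integrable lborel {t0..} (\<lambda>t. t powr (q + 1) * \<rho> t)"
  using c dissipation_terms(2) residual_nonneg
  by (intro set_integrable_of_le_dissipation[where k = "c / 2"]
      continuous_intros continuous_power cont_residual) auto

lemma integrable_value:
  assumes "2 + q < c"
  shows "set_integrable lborel {t0..} (\<lambda>t. t powr (q + 1) * \<phi> t)"
  using assms dissipation_terms(1) value_nonneg
  by (intro set_integrable_of_le_dissipation[where k = "c - 2 - q"]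
      continuous_intros continuous_power continuous_value) auto

lemma integrable_velocity:
  assumes "c + 1 + q / 2 < \<alpha>"
  shows "set_integrable lborel {t0..} (\<lambda>t. t powr (q + 1) * (norm (w' t))\<^sup>2)"
  using assms dissipation_terms(3)
  by (intro set_integrable_of_le_dissipation[where k = "\<alpha> - c - 1 - q / 2"]
      continuous_intros continuous_power continuous_velocity) auto

text \<open>Below the critical weight \<open>q + 1\<close> the pointwise rates already give integrability; this is what
  remains when the dissipation does not contain the corresponding term.\<close>

lemma integrable_value_below_rate:
  assumes "m < q + 1"
  shows "set_integrable lborel {t0..} (\<lambda>t. t powr m * \<phi> t)"
proof (rule set_integrable_powr_dominated[OF t0])
  show "m - (q + 2) < - 1" using assms by simp
  show "continuous_on {t0..} (\<lambda>t. t powr m * \<phi> t)"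
    by (intro continuous_intros continuous_power continuous_value)
  fix t assume t: "t0 \<le> t"
  show "0 \<le> t powr m * \<phi> t" using value_nonneg[OF t] by simp
  have "t powr m * \<phi> t \<le> t powr m * (energy t0 * t powr (- (q + 2)))"
    by (intro mult_left_mono value_bound[OF t]) simp
  also have "\<dots> = energy t0 * t powr (m - (q + 2))"
    by (simp add: powr_add[symmetric] algebra_simps)
  finally show "t powr m * \<phi> t \<le> energy t0 * t powr (m - (q + 2))" .
qed

lemma integrable_velocity_below_rate:
  assumes "m < q + 1"
  shows "set_integrable lborel {t0..} (\<lambda>t. t powr m * (norm (w' t))\<^sup>2)"
proof -
  obtain C where C: "\<And>t. t \<ge> t0 \<Longrightarrow> norm (w' t) \<le> C * t powr (- (q / 2 + 1))"
    using velocity_bound by blast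
  show ?thesis
  proof (rule set_integrable_powr_dominated[OF t0])
    show "m - (q + 2) < - 1" using assms by simp
    show "continuous_on {t0..} (\<lambda>t. t powr m * (norm (w' t))\<^sup>2)"
      by (intro continuous_intros continuous_power continuous_velocity)
    fix t assume t: "t0 \<le> t"
    show "0 \<le> t powr m * (norm (w' t))\<^sup>2" by simp
    have "t powr m * (norm (w' t))\<^sup>2 \<le> t powr m * (C * t powr (- (q / 2 + 1)))\<^sup>2"
      by (intro mult_left_mono power_mono C[OF t]) auto
    also have "\<dots> = C\<^sup>2 * t powr (m - (q + 2))"
      by (simp add: power_mult_distrib power2_eq_square powr_add[symmetric] algebra_simps)
    finally show "t powr m * (norm (w' t))\<^sup>2 \<le> C\<^sup>2 * t powr (m - (q + 2))" .
  qed
qed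

lemma value_bigo: "\<phi> \<in> O[at_top](\<lambda>t. t powr (- (q + 2)))"
proof (rule bigoI)
  show "\<forall>\<^sub>F t in at_top. norm (\<phi> t) \<le> energy t0 * norm (t powr (- (q + 2)))"
    using eventually_ge_at_top[of t0]
    by eventually_elim (use value_bound value_nonneg in simp)
qed

lemma residual_bigo: "(\<lambda>t. sqrt (\<rho> t)) \<in> O[at_top](\<lambda>t. t powr (- (q / 2 + 1)))"
proof (rule bigoI)
  show "\<forall>\<^sub>F t in at_top. norm (sqrt (\<rho> t))
      \<le> sqrt (2 * energy t0) * norm (t powr (- (q / 2 + 1)))"
    using eventually_ge_at_top[of t0]
  proof eventually_elim
    case (elim t)
    have "\<rho> t \<le> 2 * energy t0 * t powr (- (q + 2))"
      using residual_le[OF elim] value_bound[OF elim] by simp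
    also have "t powr (- (q + 2)) = (t powr (- (q / 2 + 1)))\<^sup>2"
      by (simp add: power2_eq_square powr_add[symmetric])
    finally have "sqrt (\<rho> t) \<le> sqrt (2 * energy t0 * (t powr (- (q / 2 + 1)))\<^sup>2)"
      by (rule real_sqrt_le_mono)
    then show ?case using residual_nonneg[OF elim] by (simp add: real_sqrt_mult)
  qed
qed

lemma velocity_bigo: "(\<lambda>t. norm (w' t)) \<in> O[at_top](\<lambda>t. t powr (- (q / 2 + 1)))"
proof -
  obtain C where C: "\<And>t. t \<ge> t0 \<Longrightarrow> norm (w' t) \<le> C * t powr (- (q / 2 + 1))"
    using velocity_bound by blast
  show ?thesis
    by (rule bigoI[where c = C], use eventually_ge_at_top[of t0] in eventually_elim)
       (use C in simp)
qed

end

section \<open>The primal-dual system as a skew-coupled inertial flow\<close>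

lemma inner_transpose_mult: "(transpose M *v p) \<bullet> u = p \<bullet> (M *v (u::real^'n))"
  for M :: "real^'n^'k"
  by (simp add: dot_lmul_matrix)

text \<open>The optimality conditions at \<open>(xs, ys, lams)\<close> allow the right-hand side to be split into the
  gradient of the gap, with the multiplier fixed at \<open>lams\<close>, and a skew coupling of the
  deviations. The penalty is quadratic in the residual, so its pairing with the deviation is twice
  its value; the surplus is the term \<open>\<rho>/2\<close> in the tangent inequality. The lower bound of the gap
  is convexity at the KKT point, where the linear terms cancel.\<close>

lemma primal_dual_skew_inertial_flow:
  fixes A :: "real^'n1^'m" and B :: "real^'n2^'m" and b :: "real^'m"
  assumes "t0 > 0" "c > 0" "q \<le> 0" "2 + q \<le> c" "c + 1 + q / 2 \<le> \<alpha>"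
    and f: "C1_convex_with_gradient f grad_f" and g: "C1_convex_with_gradient g grad_g"
    and kkt: "(xs, ys, lams) \<in> KKT_set grad_f grad_g A B b"
    and sol: "global_solution t0 (\<lambda>t. \<alpha> / t) (\<lambda>t. t / c) grad_f grad_g A B b
           x x' x'' y y' y'' lam lam' lam''"
  shows "skew_inertial_flow t0 \<alpha> c q
    (\<lambda>t. (x t - xs, y t - ys, lam t - lams))
    (\<lambda>t. (x' t, y' t, lam' t)) (\<lambda>t. (x'' t, y'' t, lam'' t))
    (\<lambda>t. (grad_f (x t) + transpose A *v (lams + (A *v x t + B *v y t - b)),
          grad_g (y t) + transpose B *v (lams + (A *v x t + B *v y t - b)), 0))
    (\<lambda>t. (transpose A *v (lam t - lams + (t / c) *\<^sub>R lam' t),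
          transpose B *v (lam t - lams + (t / c) *\<^sub>R lam' t),
          - (A *v (x t - xs + (t / c) *\<^sub>R x' t) + B *v (y t - ys + (t / c) *\<^sub>R y' t))))
    (\<lambda>t. aug_lagrangian f g A B b (x t) (y t) lams - aug_lagrangian f g A B b xs ys lams)
    (\<lambda>t. (norm (A *v x t + B *v y t - b))\<^sup>2)"
proof -
  define r where "r = (\<lambda>u z. A *v u + B *v z - b)"
  have kx: "grad_f xs = - (transpose A *v lams)" and ky: "grad_g ys = - (transpose B *v lams)"
    and feas: "r xs ys = 0"
    using kkt by (auto simp: KKT_set_def r_def)
  have r_eq: "r u z = A *v (u - xs) + B *v (z - ys)" for u z
    using feas by (simp add: r_def matrix_vector_mult_diff_distrib algebra_simps)
  have L_eq: "aug_lagrangian f g A B b u z lams - aug_lagrangian f g A B b xs ys lams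
      = f u + g z - f xs - g ys + lams \<bullet> r u z + (norm (r u z))\<^sup>2 / 2" for u z
    using feas by (simp add: aug_lagrangian_def r_def)
  have cf: "f u + grad_f u \<bullet> (z - u) \<le> f z" for u z
    using f by (intro convex_on_gderiv_above_tangent) (auto simp: C1_convex_with_gradient_def)
  have cg: "g u + grad_g u \<bullet> (z - u) \<le> g z" for u z
    using g by (intro convex_on_gderiv_above_tangent) (auto simp: C1_convex_with_gradient_def)
  have lin: "(transpose A *v p) \<bullet> (u - xs) + (transpose B *v p) \<bullet> (z - ys) = p \<bullet> r u z" for p u z
    by (simp add: inner_transpose_mult r_eq inner_add_right del: transpose_matrix_vector)
  have skew_form: "(transpose A *v p, transpose B *v p, - (A *v u + B *v z)) \<bullet> (u, z, p) = 0" for p u z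
    by (simp add: inner_transpose_mult inner_add_left inner_diff_left inner_commute[of p] del: transpose_matrix_vector)
  have dx: "(x has_vector_derivative x' t) (at t within {t0..})"
    "(x' has_vector_derivative x'' t) (at t within {t0..})"
    "(y has_vector_derivative y' t) (at t within {t0..})"
    "(y' has_vector_derivative y'' t) (at t within {t0..})"
    "(lam has_vector_derivative lam' t) (at t within {t0..})"
    "(lam' has_vector_derivative lam'' t) (at t within {t0..})" if "t \<ge> t0" for t
    using sol that by (auto simp: global_solution_def C2_with_derivs_def)
  have dr: "((\<lambda>t. r (x t) (y t)) has_vector_derivative (A *v x' t + B *v y' t)) (at t within {t0..})"
    if "t \<ge> t0" for t
    unfolding r_def
    using bounded_linear.has_vector_derivative[OF matrix_vector_mul_bounded_linear dx(1)[OF that], of A]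
      bounded_linear.has_vector_derivative[OF matrix_vector_mul_bounded_linear dx(3)[OF that], of B]
    by (auto intro!: derivative_eq_intros)
  have chain: "((\<lambda>t. h (u t)) has_real_derivative (gr (u t) \<bullet> u')) (at t within {t0..})"
    if "GDERIV h (u t) :> gr (u t)" "(u has_vector_derivative u') (at t within {t0..})"
    for h :: "'e::real_inner \<Rightarrow> real" and gr u u' t
    using has_derivative_compose[OF that(2)[unfolded has_vector_derivative_def]
        that(1)[unfolded gderiv_def]]
    unfolding has_field_derivative_def
    by (rule has_derivative_eq_rhs) (auto simp: fun_eq_iff inner_commute)
  have "skew_inertial_flow t0 \<alpha> c q
    (\<lambda>t. (x t - xs, y t - ys, lam t - lams))
    (\<lambda>t. (x' t, y' t, lam' t)) (\<lambda>t. (x'' t, y'' t, lam'' t))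
    (\<lambda>t. (grad_f (x t) + transpose A *v (lams + r (x t) (y t)),
          grad_g (y t) + transpose B *v (lams + r (x t) (y t)), 0))
    (\<lambda>t. (transpose A *v (lam t - lams + (t / c) *\<^sub>R lam' t),
          transpose B *v (lam t - lams + (t / c) *\<^sub>R lam' t),
          - (A *v (x t - xs + (t / c) *\<^sub>R x' t) + B *v (y t - ys + (t / c) *\<^sub>R y' t))))
    (\<lambda>t. aug_lagrangian f g A B b (x t) (y t) lams - aug_lagrangian f g A B b xs ys lams)
    (\<lambda>t. (norm (r (x t) (y t)))\<^sup>2)"
  proof
    fix t assume t: "t0 \<le> t"
    let ?r = "r (x t) (y t)"
    have eqs: "x'' t + (\<alpha> / t) *\<^sub>R x' t =
          - grad_f (x t) - transpose A *v (lam t + (t / c) *\<^sub>R lam' t) - transpose A *v ?r"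
      "y'' t + (\<alpha> / t) *\<^sub>R y' t =
          - grad_g (y t) - transpose B *v (lam t + (t / c) *\<^sub>R lam' t) - transpose B *v ?r"
      "lam'' t + (\<alpha> / t) *\<^sub>R lam' t =
          A *v (x t + (t / c) *\<^sub>R x' t) + B *v (y t + (t / c) *\<^sub>R y' t) - b"
      using sol t by (auto simp: global_solution_def r_def)
    have b: "b = A *v xs + B *v ys" using feas by (simp add: r_def)
    show "(x'' t, y'' t, lam'' t) + (\<alpha> / t) *\<^sub>R (x' t, y' t, lam' t) =
       - (grad_f (x t) + transpose A *v (lams + ?r), grad_g (y t) + transpose B *v (lams + ?r), 0)
       - (transpose A *v (lam t - lams + (t / c) *\<^sub>R lam' t),
          transpose B *v (lam t - lams + (t / c) *\<^sub>R lam' t),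
          - (A *v (x t - xs + (t / c) *\<^sub>R x' t) + B *v (y t - ys + (t / c) *\<^sub>R y' t)))"
      using eqs b
      by (simp add: matrix_vector_mult_diff_distrib matrix_vector_right_distrib algebra_simps
          del: transpose_matrix_vector)
    show "((\<lambda>t. (x t - xs, y t - ys, lam t - lams)) has_vector_derivative (x' t, y' t, lam' t))
        (at t within {t0..})"
      using dx[OF t] by (auto intro!: derivative_eq_intros has_vector_derivative_Pair)
    show "((\<lambda>t. (x' t, y' t, lam' t)) has_vector_derivative (x'' t, y'' t, lam'' t))
        (at t within {t0..})"
      using dx[OF t] by (intro has_vector_derivative_Pair)
    have df: "((\<lambda>t. f (x t)) has_real_derivative grad_f (x t) \<bullet> x' t) (at t within {t0..})"
      using f dx(1)[OF t] by (intro chain) (auto simp: C1_convex_with_gradient_def)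
    have dg: "((\<lambda>t. g (y t)) has_real_derivative grad_g (y t) \<bullet> y' t) (at t within {t0..})"
      using g dx(3)[OF t] by (intro chain) (auto simp: C1_convex_with_gradient_def)
    have dq: "((\<lambda>t. lams \<bullet> r (x t) (y t) + (norm (r (x t) (y t)))\<^sup>2 / 2) has_real_derivative
        (lams + ?r) \<bullet> (A *v x' t + B *v y' t)) (at t within {t0..})"
      unfolding power2_norm_eq_inner has_field_derivative_def
      by (rule has_derivative_eq_rhs,
          (rule derivative_intros has_derivative_inner dr[OF t, unfolded has_vector_derivative_def])+)
         (auto simp: fun_eq_iff inner_commute algebra_simps)
    show "((\<lambda>t. aug_lagrangian f g A B b (x t) (y t) lams - aug_lagrangian f g A B b xs ys lams)
        has_real_derivative
        (grad_f (x t) + transpose A *v (lams + ?r), grad_g (y t) + transpose B *v (lams + ?r), 0)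
          \<bullet> (x' t, y' t, lam' t)) (at t within {t0..})"
    proof -
      have "((\<lambda>t. f (x t) + g (y t) + (lams \<bullet> r (x t) (y t) + (norm (r (x t) (y t)))\<^sup>2 / 2)
          + (- f xs - g ys)) has_real_derivative
          grad_f (x t) \<bullet> x' t + grad_g (y t) \<bullet> y' t
          + (lams + ?r) \<bullet> (A *v x' t + B *v y' t) + 0) (at t within {t0..})"
        by (intro DERIV_add df dg dq DERIV_const)
      then show ?thesis
        unfolding L_eq
        by (simp add: inner_transpose_mult inner_add_left inner_add_right algebra_simps
            del: transpose_matrix_vector)
    qed
    show "(transpose A *v (lam t - lams + (t / c) *\<^sub>R lam' t),
          transpose B *v (lam t - lams + (t / c) *\<^sub>R lam' t),
          - (A *v (x t - xs + (t / c) *\<^sub>R x' t) + B *v (y t - ys + (t / c) *\<^sub>R y' t)))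
        \<bullet> (c *\<^sub>R (x t - xs, y t - ys, lam t - lams) + t *\<^sub>R (x' t, y' t, lam' t)) = 0"
    proof -
      have "c *\<^sub>R (x t - xs, y t - ys, lam t - lams) + t *\<^sub>R (x' t, y' t, lam' t)
        = c *\<^sub>R (x t - xs + (t / c) *\<^sub>R x' t, y t - ys + (t / c) *\<^sub>R y' t,
            lam t - lams + (t / c) *\<^sub>R lam' t)"
        using \<open>c > 0\<close> by (simp add: scaleR_add_right)
      then show ?thesis using skew_form by (simp only: inner_scaleR_right mult_zero_right)
    qed
    show "aug_lagrangian f g A B b (x t) (y t) lams - aug_lagrangian f g A B b xs ys lams
          + (norm ?r)\<^sup>2 / 2
        \<le> (grad_f (x t) + transpose A *v (lams + ?r), grad_g (y t) + transpose B *v (lams + ?r), 0)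
          \<bullet> (x t - xs, y t - ys, lam t - lams)"
      using cf[of "x t" xs] cg[of "y t" ys] lin[of "lams + ?r" "x t" "y t"]
      unfolding L_eq
      by (simp add: inner_add_left inner_diff_right power2_norm_eq_inner
          del: transpose_matrix_vector)
    show "(norm ?r)\<^sup>2 / 2
        \<le> aug_lagrangian f g A B b (x t) (y t) lams - aug_lagrangian f g A B b xs ys lams"
      using cf[of xs "x t"] cg[of ys "y t"] lin[of lams "x t" "y t"]
      unfolding L_eq by (simp add: kx ky del: transpose_matrix_vector)
    show "0 \<le> (norm ?r)\<^sup>2" by simp
  next
    show "continuous_on {t0..} (\<lambda>t. (norm (r (x t) (y t)))\<^sup>2)"
    proof -
      have "continuous_on {t0..} (\<lambda>t. r (x t) (y t))"
        by (rule continuous_on_vector_derivative, rule dr) simp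
      then show ?thesis by (intro continuous_intros)
    qed
  qed (use assms in auto)
  then show ?thesis by (simp only: r_def)
qed

section \<open>Convergence rates of the primal-dual system\<close>

theorem corollary2p8:
  fixes f :: "real^'n1 \<Rightarrow> real" and g :: "real^'n2 \<Rightarrow> real"
    and grad_f :: "real^'n1 \<Rightarrow> real^'n1" and grad_g :: "real^'n2 \<Rightarrow> real^'n2"
    and A :: "real^'n1^'m" and B :: "real^'n2^'m" and b :: "real^'m"
    and t0 \<alpha> \<beta>0 :: real
    and xs :: "real^'n1" and ys :: "real^'n2" and lams :: "real^'m"
    and x x' x'' :: "real \<Rightarrow> real^'n1"
    and y y' y'' :: "real \<Rightarrow> real^'n2"
    and lam lam' lam'' :: "real \<Rightarrow> real^'m"
  assumes "t0 > 0"
    and "C1_convex_with_gradient f grad_f"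
    and "C1_convex_with_gradient g grad_g"
    and "KKT_set grad_f grad_g A B b \<noteq> {}"
    and "\<alpha> > 0" and "\<beta>0 > 0"
    and "(xs, ys, lams) \<in> KKT_set grad_f grad_g A B b"
    and "global_solution t0 (\<lambda>t. \<alpha> / t) (\<lambda>t. t / (\<beta>0 * \<alpha>)) grad_f grad_g A B b
           x x' x'' y y' y'' lam lam' lam''"
  shows
    "(\<alpha> \<le> 3 \<and> \<beta>0 = 2/3 \<longrightarrow>
        (\<lambda>t. aug_lagrangian f g A B b (x t) (y t) lams - aug_lagrangian f g A B b xs ys lams)
          \<in> O[at_top](\<lambda>t. t powr (- (2 * \<alpha> / 3))) \<and>
        (\<lambda>t. norm (A *v x t + B *v y t - b)) \<in> O[at_top](\<lambda>t. t powr (- (\<alpha> / 3))) \<and>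
        set_integrable lborel {t0..}
          (\<lambda>t. t powr (2 * \<alpha> / 3 - 1) * (norm (A *v x t + B *v y t - b))\<^sup>2) \<and>
        (\<forall>m \<in> {-1 <..< 2 * \<alpha> / 3 - 1}. set_integrable lborel {t0..}
          (\<lambda>t. t powr m * (aug_lagrangian f g A B b (x t) (y t) lams
                             - aug_lagrangian f g A B b xs ys lams))) \<and>
        (\<forall>m \<in> {-1 <..< 2 * \<alpha> / 3 - 1}. set_integrable lborel {t0..}
          (\<lambda>t. t powr m * ((norm (x' t))\<^sup>2 + (norm (y' t))\<^sup>2 + (norm (lam' t))\<^sup>2))) \<and>
        (\<forall>m \<in> {0 <..< \<alpha> / 3}.
          (\<lambda>t. norm (x' t) + norm (y' t) + norm (lam' t)) \<in> O[at_top](\<lambda>t. t powr (- m))) \<and>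
        (\<alpha> < 3 \<longrightarrow>
          (\<lambda>t. norm (x' t) + norm (y' t) + norm (lam' t)) \<in> O[at_top](\<lambda>t. t powr (- (\<alpha> / 3))))) \<and>
     (\<alpha> > 3 \<and> \<beta>0 \<in> {2 / \<alpha> <..< 1 - 1 / \<alpha>} \<longrightarrow>
        (\<lambda>t. aug_lagrangian f g A B b (x t) (y t) lams - aug_lagrangian f g A B b xs ys lams)
          \<in> O[at_top](\<lambda>t. t powr (- 2)) \<and>
        (\<lambda>t. norm (A *v x t + B *v y t - b)) \<in> O[at_top](\<lambda>t. t powr (- 1)) \<and>
        set_integrable lborel {t0..} (\<lambda>t. t * (norm (A *v x t + B *v y t - b))\<^sup>2) \<and>
        set_integrable lborel {t0..}
          (\<lambda>t. t * (aug_lagrangian f g A B b (x t) (y t) lams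
                      - aug_lagrangian f g A B b xs ys lams)) \<and>
        set_integrable lborel {t0..}
          (\<lambda>t. t * ((norm (x' t))\<^sup>2 + (norm (y' t))\<^sup>2 + (norm (lam' t))\<^sup>2)) \<and>
        (\<lambda>t. norm (x' t) + norm (y' t) + norm (lam' t)) \<in> O[at_top](\<lambda>t. t powr (- 1)))"
proof -
  define W' where "W' = (\<lambda>t. (x' t, y' t, lam' t))"
  let ?\<phi> = "\<lambda>t. aug_lagrangian f g A B b (x t) (y t) lams - aug_lagrangian f g A B b xs ys lams"
  let ?\<rho> = "\<lambda>t. (norm (A *v x t + B *v y t - b))\<^sup>2"
  have flow: "\<exists>w w'' G S. skew_inertial_flow t0 \<alpha> (\<beta>0 * \<alpha>) q w W' w'' G S ?\<phi> ?\<rho>"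
    if "q \<le> 0" "2 + q \<le> \<beta>0 * \<alpha>" "\<beta>0 * \<alpha> + 1 + q / 2 \<le> \<alpha>" for q
    unfolding W'_def
    by (intro exI, rule primal_dual_skew_inertial_flow[OF assms(1) _ that assms(2,3,7,8)])
       (use assms(5,6) in simp)
  have normW': "(norm (W' t))\<^sup>2 = (norm (x' t))\<^sup>2 + (norm (y' t))\<^sup>2 + (norm (lam' t))\<^sup>2" for t
    by (simp add: W'_def norm_prod_def)
  have speeds: "(\<lambda>t. norm (x' t) + norm (y' t) + norm (lam' t)) \<in> O[at_top](\<lambda>t. norm (W' t))"
  proof (rule bigoI[where c = 3], rule always_eventually, rule allI)
    fix t
    have "norm (x' t) \<le> norm (W' t)" "norm (y' t) \<le> norm (W' t)" "norm (lam' t) \<le> norm (W' t)"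
      by (rule power2_le_imp_le; simp add: normW')+
    then show "norm (norm (x' t) + norm (y' t) + norm (lam' t)) \<le> 3 * norm (norm (W' t))"
      by simp
  qed
  show ?thesis
  proof (rule conjI; rule impI)
    \<comment> \<open>For \<open>c = 2 * \<alpha> / 3\<close> both rate constraints read \<open>q \<le> c - 2\<close>; the largest \<open>q\<close> is best.\<close>
    assume slow: "\<alpha> \<le> 3 \<and> \<beta>0 = 2 / 3"
    have "\<beta>0 * \<alpha> = 2 * \<alpha> / 3" using slow by simp
    have "2 * \<alpha> / 3 - 2 \<le> 0" "2 + (2 * \<alpha> / 3 - 2) \<le> \<beta>0 * \<alpha>"
      "\<beta>0 * \<alpha> + 1 + (2 * \<alpha> / 3 - 2) / 2 \<le> \<alpha>"
      unfolding \<open>\<beta>0 * \<alpha> = 2 * \<alpha> / 3\<close> using slow by (simp_all add: diff_divide_distrib)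
    from flow[OF this] obtain w w'' G S where
      "skew_inertial_flow t0 \<alpha> (\<beta>0 * \<alpha>) (2 * \<alpha> / 3 - 2) w W' w'' G S ?\<phi> ?\<rho>" by blast
    then interpret skew_inertial_flow t0 \<alpha> "\<beta>0 * \<alpha>" "2 * \<alpha> / 3 - 2" w W' w'' G S ?\<phi> ?\<rho> .
    have exps: "- (2 * \<alpha> / 3 - 2 + 2) = - (2 * \<alpha> / 3)"
      "- ((2 * \<alpha> / 3 - 2) / 2 + 1) = - (\<alpha> / 3)" "2 * \<alpha> / 3 - 2 + 1 = 2 * \<alpha> / 3 - 1"
      by (simp_all add: diff_divide_distrib)
    have speed: "(\<lambda>t. norm (x' t) + norm (y' t) + norm (lam' t)) \<in> O[at_top](\<lambda>t. t powr (- (\<alpha> / 3)))"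
      using landau_o.big_trans[OF speeds velocity_bigo] unfolding exps .
    have slower: "(\<lambda>t. norm (x' t) + norm (y' t) + norm (lam' t)) \<in> O[at_top](\<lambda>t. t powr (- m))"
      if "m < \<alpha> / 3" for m
    proof (rule landau_o.big_trans[OF speed], rule bigoI[where c = 1])
      show "\<forall>\<^sub>F t in at_top. norm (t powr (- (\<alpha> / 3))) \<le> 1 * norm (t powr (- m))"
        using eventually_ge_at_top[of 1]
        by eventually_elim (use that in \<open>simp add: powr_mono\<close>)
    qed
    show "?\<phi> \<in> O[at_top](\<lambda>t. t powr (- (2 * \<alpha> / 3))) \<and>
        (\<lambda>t. norm (A *v x t + B *v y t - b)) \<in> O[at_top](\<lambda>t. t powr (- (\<alpha> / 3))) \<and>
        set_integrable lborel {t0..}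
          (\<lambda>t. t powr (2 * \<alpha> / 3 - 1) * (norm (A *v x t + B *v y t - b))\<^sup>2) \<and>
        (\<forall>m \<in> {-1 <..< 2 * \<alpha> / 3 - 1}. set_integrable lborel {t0..}
          (\<lambda>t. t powr m * (?\<phi> t))) \<and>
        (\<forall>m \<in> {-1 <..< 2 * \<alpha> / 3 - 1}. set_integrable lborel {t0..}
          (\<lambda>t. t powr m * ((norm (x' t))\<^sup>2 + (norm (y' t))\<^sup>2 + (norm (lam' t))\<^sup>2))) \<and>
        (\<forall>m \<in> {0 <..< \<alpha> / 3}.
          (\<lambda>t. norm (x' t) + norm (y' t) + norm (lam' t)) \<in> O[at_top](\<lambda>t. t powr (- m))) \<and>
        (\<alpha> < 3 \<longrightarrow>
          (\<lambda>t. norm (x' t) + norm (y' t) + norm (lam' t)) \<in> O[at_top](\<lambda>t. t powr (- (\<alpha> / 3))))"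
      using value_bigo[unfolded exps] residual_bigo[unfolded exps real_sqrt_abs abs_norm_cancel]
        integrable_residual[unfolded exps] integrable_value_below_rate[unfolded exps]
        integrable_velocity_below_rate[unfolded exps normW'] speed slower
      by (intro conjI ballI impI; simp)
  next
    assume fast: "\<alpha> > 3 \<and> \<beta>0 \<in> {2 / \<alpha> <..< 1 - 1 / \<alpha>}"
    then have gap: "2 < \<beta>0 * \<alpha>" "\<beta>0 * \<alpha> + 1 < \<alpha>"
      by (auto simp: field_simps)
    obtain w w'' G S where "skew_inertial_flow t0 \<alpha> (\<beta>0 * \<alpha>) 0 w W' w'' G S ?\<phi> ?\<rho>"
      using flow[of 0] gap by auto
    then interpret skew_inertial_flow t0 \<alpha> "\<beta>0 * \<alpha>" 0 w W' w'' G S ?\<phi> ?\<rho> .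
    have weight: "set_integrable lborel {t0..} (\<lambda>t. t * h t)"
      if "set_integrable lborel {t0..} (\<lambda>t. t powr (0 + 1) * h t)" for h :: "real \<Rightarrow> real"
      using that t0 by (subst set_integrable_cong[OF refl refl, of _ _ "\<lambda>t. t powr (0 + 1) * h t"]) auto
    show "?\<phi> \<in> O[at_top](\<lambda>t. t powr (- 2)) \<and>
        (\<lambda>t. norm (A *v x t + B *v y t - b)) \<in> O[at_top](\<lambda>t. t powr (- 1)) \<and>
        set_integrable lborel {t0..} (\<lambda>t. t * (norm (A *v x t + B *v y t - b))\<^sup>2) \<and>
        set_integrable lborel {t0..} (\<lambda>t. t * (?\<phi> t)) \<and>
        set_integrable lborel {t0..}
          (\<lambda>t. t * ((norm (x' t))\<^sup>2 + (norm (y' t))\<^sup>2 + (norm (lam' t))\<^sup>2)) \<and>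
        (\<lambda>t. norm (x' t) + norm (y' t) + norm (lam' t)) \<in> O[at_top](\<lambda>t. t powr (- 1))"
      using value_bigo residual_bigo weight[OF integrable_residual]
        weight[OF integrable_value] weight[OF integrable_velocity] gap
        landau_o.big_trans[OF speeds velocity_bigo]
      by (intro conjI; simp add: normW')
  qed
qed

end
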